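(* The space $E(1)$ of idempotents of rank $1$ in $M_2$ is a hyperboloid of one sheet.
   Context: $M_2$ is the semigroup of linear endomorphisms of a real plane, represented as the multiplicative semigroup of real $2\times 2$ matrices relative to a fixed ordered orthonormal basis, and identified with $\mathbb{R}^4$ by listing entries row-wise, with the usual inner product $\langle x,y\rangle = \operatorname{tr}(x^* y)$, where $x^*$ is the transpose of $x$. An element $e\in M_2$ is idempotent if $e^2=e$; $E(1)$ is the set of idempotents of rank $1$ in $M_2$. A subset of $\mathbb{R}^4$ is called a hyperboloid of one sheet if it is contained in some three-dimensional affine subspace $H$ of $\mathbb{R}^4$ and there are rectangular Cartesian (orthonormal) coordinates $(X,Y,Z)$ on $H$, with some origin in $H$, and reals $p,q,r>0$ such that the subset is the full solution set in $H$ of $X^2/p^2+Y^2/q^2-Z^2/r^2=1$. *)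

theory Defs
  imports "HOL-Analysis.Analysis"
begin

definition rank_one_idempotents :: "(real^2^2) set" where
  "rank_one_idempotents = {e. e ** e = e \<and> rank e = 1}"

definition rowwise :: "real^2^2 \<Rightarrow> real^4" where
  "rowwise x = vector [x$1$1, x$1$2, x$2$1, x$2$2]"

lemma vector_4 [simp]:
  "(vector [a, b, c, d] :: 'a::zero^4) $ 1 = a"
  "(vector [a, b, c, d] :: 'a::zero^4) $ 2 = b"
  "(vector [a, b, c, d] :: 'a::zero^4) $ 3 = c"
  "(vector [a, b, c, d] :: 'a::zero^4) $ 4 = d"
  unfolding vector_def by simp_all

text \<open>Under this identification the trace form is the standard inner product.\<close>

lemma inner_rowwise: "rowwise x \<bullet> rowwise y = trace (transpose x ** y)"
  by (simp add: rowwise_def trace_def transpose_def matrix_matrix_mult_def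
      inner_vec_def sum_2 sum_4 vector_4)

lemma bij_rowwise: "bij rowwise"
proof (rule bijI)
  show "inj rowwise"
  proof (rule injI)
    fix x y :: "real^2^2"
    assume "rowwise x = rowwise y"
    then have "\<forall>i. rowwise x $ i = rowwise y $ i"
      by simp
    then show "x = y"
      by (simp add: rowwise_def vec_eq_iff forall_2 forall_4 vector_4)
  qed
  show "surj rowwise"
  proof (rule surjI)
    fix z :: "real^4"
    show "rowwise (vector [vector [z$1, z$2], vector [z$3, z$4]]) = z"
      by (simp add: rowwise_def vec_eq_iff forall_4 vector_4)
  qed
qed

text \<open>
  An origin \<open>c\<close> in the affine space \<open>H\<close> and orthonormal directions \<open>u\<close>, \<open>v\<close>, \<open>w\<close> of \<open>H\<close>;
  since \<open>H\<close> has dimension 3, these directions form a basis of its direction space. The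
  coordinates of a point \<open>x\<close> of \<open>H\<close> are the inner products of \<open>x - c\<close> with \<open>u\<close>, \<open>v\<close> and \<open>w\<close>.
\<close>

definition cartesian_frame ::
  "(real^4) set \<Rightarrow> real^4 \<Rightarrow> real^4 \<Rightarrow> real^4 \<Rightarrow> real^4 \<Rightarrow> bool" where
  "cartesian_frame H c u v w \<longleftrightarrow>
     affine H \<and> aff_dim H = 3 \<and>
     c \<in> H \<and> c + u \<in> H \<and> c + v \<in> H \<and> c + w \<in> H \<and>
     norm u = 1 \<and> norm v = 1 \<and> norm w = 1 \<and>
     u \<bullet> v = 0 \<and> u \<bullet> w = 0 \<and> v \<bullet> w = 0"

definition hyperboloid_of_one_sheet :: "(real^4) set \<Rightarrow> bool" where
  "hyperboloid_of_one_sheet S \<longleftrightarrow>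
     (\<exists>H c u v w p q r.
        cartesian_frame H c u v w \<and> 0 < p \<and> 0 < q \<and> 0 < r \<and>
        S = {x \<in> H. ((x - c) \<bullet> u)\<^sup>2 / p\<^sup>2 + ((x - c) \<bullet> v)\<^sup>2 / q\<^sup>2
                     - ((x - c) \<bullet> w)\<^sup>2 / r\<^sup>2 = 1})"

end

theory Submission
  imports Defs
begin

text \<open>By Cayley-Hamilton, the idempotents of rank 1 are exactly the matrices of trace 1 and
  determinant 0 (\<open>rank_one_idempotent_2x2_iff\<close>). The trace condition cuts out a
  hyperplane of 4-space, and on it the determinant condition is a quadric. Polarization, 4ab = (a +
  b)^2 - (a - b)^2, applied to both products in \<open>x$1 * x$4 = x$2 * x$3\<close> diagonalizes
  it: (x1 - x4)^2 + (x2 + x3)^2 - (x2 - x3)^2 = 1. These three linear forms are, up to a common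
  scale, orthonormal coordinates on the hyperplane.\<close>

lemma rank_2x2_eq_1_iff:
  fixes e :: "real^2^2"
  shows "rank e = 1 \<longleftrightarrow> e \<noteq> 0 \<and> det e = 0"
proof -
  have "rank e \<le> 2"
    using rank_bound[of e] by simp
  moreover have "rank e = 0 \<longleftrightarrow> e = 0"
    by (rule rank_eq_0)
  moreover have "det e = 0 \<longleftrightarrow> rank e < 2"
    by (simp add: det_eq_0_rank)
  ultimately show ?thesis
    by linarith
qed

text \<open>Cayley--Hamilton reads \<open>e\<^sup>2 = tr e \<cdot> e\<close> when \<open>det e = 0\<close>.\<close>

lemma rank_one_idempotent_2x2_iff:
  "e \<in> rank_one_idempotents \<longleftrightarrow> trace e = 1 \<and> det e = 0"
proof -
  have "e ** e = trace e *\<^sub>R e" if "det e = 0"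
    using that
    by (simp add: vec_eq_iff forall_2 matrix_matrix_mult_def sum_2 trace_def det_2 algebra_simps)
  moreover have "trace e *\<^sub>R e = e \<longleftrightarrow> trace e = 1 \<or> e = 0"
    using scaleR_cancel_right[of "trace e" e 1] by auto
  moreover have "e \<noteq> 0" if "trace e = 1"
    using that by (auto simp: trace_def sum_2)
  ultimately show ?thesis
    unfolding rank_one_idempotents_def mem_Collect_eq rank_2x2_eq_1_iff by metis
qed

lemma rank_one_idempotents_rowwise:
  "rowwise ` rank_one_idempotents = {x. x$1 + x$4 = 1 \<and> x$1 * x$4 = x$2 * x$3}"
proof -
  have "e \<in> rank_one_idempotents \<longleftrightarrow>
      rowwise e \<in> {x. x$1 + x$4 = 1 \<and> x$1 * x$4 = x$2 * x$3}" for e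
    by (auto simp: rank_one_idempotent_2x2_iff rowwise_def trace_def sum_2 det_2)
  then show ?thesis
    \<comment> \<open>The equivalence only speaks of points \<open>rowwise e\<close>; surjectivity
      makes every solution \<open>x\<close> such a point.\<close>
    using bij_is_surj[OF bij_rowwise] by (fast elim: surjE)
qed

theorem proposition3:
  shows "hyperboloid_of_one_sheet (rowwise ` rank_one_idempotents)"
proof -
  \<comment> \<open>\<open>s\<close> plays two roles: it normalizes the directions below, and it is
    the common value of all three semi-axes.\<close>
  define s :: real where "s = 1 / sqrt 2"
  have s: "0 < s" "s\<^sup>2 = 1/2" "s * s = 1/2"
    by (simp_all add: s_def power_divide)
  \<comment> \<open>As matrices, \<open>n\<close> is the identity, so \<open>n \<bullet> x\<close>
    is the trace, and \<open>c\<close> is half the identity, the point of \<open>H\<close> nearest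
    to 0. The traceless directions split into symmetric ones (\<open>u\<close>, \<open>v\<close>)
    and the antisymmetric one (\<open>w\<close>), which carries the minus sign.\<close>
  define n c u v w :: "real^4" where
    "n = vector [1, 0, 0, 1]" and "c = vector [1/2, 0, 0, 1/2]" and
    "u = vector [s, 0, 0, -s]" and "v = vector [0, s, s, 0]" and "w = vector [0, s, -s, 0]"
  define H where "H = {x. n \<bullet> x = 1}"
  note vecs = n_def c_def u_def v_def w_def inner_vec_def sum_4
  have H: "x \<in> H \<longleftrightarrow> x$1 + x$4 = 1" for x
    by (simp add: H_def vecs)
  have "n \<noteq> 0"
    by (auto simp: n_def vec_eq_iff forall_4)
  then have "affine H" "aff_dim H = 3"
    by (simp_all add: H_def affine_hyperplane aff_dim_hyperplane)
  then have "cartesian_frame H c u v w"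
    by (simp add: cartesian_frame_def H norm_eq_1 vecs s)
  moreover have "rowwise ` rank_one_idempotents =
      {x \<in> H. ((x - c) \<bullet> u)\<^sup>2 / s\<^sup>2 + ((x - c) \<bullet> v)\<^sup>2 / s\<^sup>2 - ((x - c) \<bullet> w)\<^sup>2 / s\<^sup>2 = 1}"
  proof -
    have "x$1 * x$4 = x$2 * x$3 \<longleftrightarrow>
        ((x - c) \<bullet> u)\<^sup>2 / s\<^sup>2 + ((x - c) \<bullet> v)\<^sup>2 / s\<^sup>2 - ((x - c) \<bullet> w)\<^sup>2 / s\<^sup>2 = 1"
      if "x \<in> H" for x
    proof -
      have x4: "x$4 = 1 - x$1"
        using that by (simp add: H)
      \<comment> \<open>On \<open>H\<close>, \<open>2 * x$1 - 1\<close> is x1 - x4; the factor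
        \<open>s\<close> cancels against the semi-axes.\<close>
      have "(x - c) \<bullet> u = s * (2 * x$1 - 1)" "(x - c) \<bullet> v = s * (x$2 + x$3)"
        "(x - c) \<bullet> w = s * (x$2 - x$3)"
        by (simp_all add: vecs x4 algebra_simps)
      then have "((x - c) \<bullet> u)\<^sup>2 / s\<^sup>2 + ((x - c) \<bullet> v)\<^sup>2 / s\<^sup>2 - ((x - c) \<bullet> w)\<^sup>2 / s\<^sup>2 =
          (2 * x$1 - 1)\<^sup>2 + (x$2 + x$3)\<^sup>2 - (x$2 - x$3)\<^sup>2"
        using s(1) by (simp add: power_mult_distrib)
      also have "\<dots> = 1 - 4 * (x$1 * x$4 - x$2 * x$3)"
        by (simp add: x4 power2_eq_square algebra_simps)
      finally show ?thesis
        by auto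
    qed
    then show ?thesis
      by (auto simp: rank_one_idempotents_rowwise H)
  qed
  ultimately show ?thesis
    unfolding hyperboloid_of_one_sheet_def using s(1) by blast
qed

end
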